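(* There is no constant $\epsilon>0$ for which there exists a PIVOT algorithm for Correlation Clustering with approximation factor $3-\epsilon$.
   Context: Correlation Clustering: given a graph $G=(V,E)$, output a clustering (partition) $C=\{C_1,\dots,C_k\}$ of $V$ minimizing $|E\triangle E_C|$, where $E_C=\bigcup_i\binom{C_i}{2}$. A PIVOT algorithm is any algorithm of the following form: while $V\neq\emptyset$, pick (by an arbitrary criterion) a pivot node $u$ of the current graph, create a cluster consisting of $u$ and all its neighbors in the current graph, and remove these nodes and their incident edges from the graph; the algorithm may not otherwise modify the graph. Approximation factor $\rho$ means that on every input the output has cost at most $\rho$ times the optimum. *)

theory Defs
  imports Complex_Main "HOL-Library.Disjoint_Sets"
begin

definition pairs :: "'a set \<Rightarrow> 'a set set" where
  "pairs X = {e. e \<subseteq> X \<and> card e = 2}"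

definition finite_graph :: "'a set \<Rightarrow> 'a set set \<Rightarrow> bool" where
  "finite_graph V E \<longleftrightarrow> finite V \<and> E \<subseteq> pairs V"

definition cluster_edges :: "'a set set \<Rightarrow> 'a set set" where
  "cluster_edges C = (\<Union>X\<in>C. pairs X)"

definition cost :: "'a set set \<Rightarrow> 'a set set \<Rightarrow> nat" where
  "cost E C = card (sym_diff E (cluster_edges C))"

definition opt_cost :: "'a set \<Rightarrow> 'a set set \<Rightarrow> nat" where
  "opt_cost V E = Min (cost E ` {C. partition_on V C})"

definition closed_nbhd :: "'a set \<Rightarrow> 'a set set \<Rightarrow> 'a \<Rightarrow> 'a set" where
  "closed_nbhd V E u = insert u {v \<in> V. {u, v} \<in> E}"

text \<open>
  \<open>pivot_output V E C\<close> holds if some sequence of pivot choices on the graph \<open>(V, E)\<close>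
  produces the clustering \<open>C\<close>.
\<close>
inductive pivot_output :: "'a set \<Rightarrow> 'a set set \<Rightarrow> 'a set set \<Rightarrow> bool" where
  stop: "pivot_output {} E {}"
| pick: "u \<in> V \<Longrightarrow> K = closed_nbhd V E u \<Longrightarrow>
    pivot_output (V - K) {e \<in> E. e \<inter> K = {}} C \<Longrightarrow>
    pivot_output V E (insert K C)"

text \<open>
  An algorithm maps each input graph to its output clustering. Only the form of the runs is
  constrained: pivots may be chosen using the whole input graph and all earlier choices, and
  no computability or running-time requirement is imposed.
\<close>
definition pivot_algorithm :: "('a set \<Rightarrow> 'a set set \<Rightarrow> 'a set set) \<Rightarrow> bool" where
  "pivot_algorithm A \<longleftrightarrow> (\<forall>V E. finite_graph V E \<longrightarrow> pivot_output V E (A V E))"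

definition approximation_factor ::
  "('a set \<Rightarrow> 'a set set \<Rightarrow> 'a set set) \<Rightarrow> real \<Rightarrow> bool" where
  "approximation_factor A \<rho> \<longleftrightarrow>
    (\<forall>V E. finite_graph V E \<longrightarrow> real (cost E (A V E)) \<le> \<rho> * real (opt_cost V E))"

end

theory Submission
  imports Defs
begin

text \<open>
  Take two disjoint cliques \<open>A\<close> and \<open>B\<close> of size \<open>n\<close> joined by a perfect matching. The clustering
  \<open>{A, B}\<close> pays only for the \<open>n\<close> matching edges. By symmetry the first pivot \<open>u\<close> may be taken
  in \<open>A\<close>, and its cluster is \<open>A\<close> together with the partner \<open>x\<close> of \<open>u\<close>. This costs \<open>n - 1\<close>
  non-edges between \<open>x\<close> and \<open>A\<close>, \<open>n - 1\<close> edges between \<open>x\<close> and the rest of \<open>B\<close>, and the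
  \<open>n - 1\<close> other matching edges, whatever the later pivots are. The ratio
  \<open>3 (n - 1) / n\<close> tends to 3.
\<close>

lemma pair_in_pairs_iff: "{a, b} \<in> pairs X \<longleftrightarrow> a \<in> X \<and> b \<in> X \<and> a \<noteq> b"
  by (auto simp: pairs_def card_2_iff doubleton_eq_iff)

lemma pairs_mono: "X \<subseteq> Y \<Longrightarrow> pairs X \<subseteq> pairs Y"
  by (auto simp: pairs_def)

lemma finite_pairs: "finite X \<Longrightarrow> finite (pairs X)"
  by (rule finite_subset[of _ "Pow X"]) (auto simp: pairs_def)

lemma cluster_edges_insert: "cluster_edges (insert X C) = pairs X \<union> cluster_edges C"
  by (simp add: cluster_edges_def)

lemma cluster_edges_subset:
  assumes "\<And>X. X \<in> C \<Longrightarrow> X \<subseteq> V"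
  shows "cluster_edges C \<subseteq> pairs V"
  unfolding cluster_edges_def using assms pairs_mono by blast

text \<open>Applied to the graph left after the first pivot, this confines all later clusters to
  vertices outside the first one. Nothing else about the later pivots enters the lower
  bound.\<close>

lemma pivot_output_subset:
  assumes "pivot_output V E C" "X \<in> C"
  shows "X \<subseteq> V"
  using assms by (induction) (auto simp: closed_nbhd_def)

lemma opt_cost_le:
  assumes "finite V" "partition_on V C"
  shows "opt_cost V E \<le> cost E C"
  unfolding opt_cost_def
  using assms by (auto intro!: Min_le simp: finitely_many_partition_on)

definition prism :: "('a \<Rightarrow> 'a) \<Rightarrow> 'a set \<Rightarrow> 'a set \<Rightarrow> 'a set set" where
  "prism f A B = pairs A \<union> pairs B \<union> (\<lambda>x. {x, f x}) ` A"

text \<open>The matching is given by an involution exchanging the two sides, not just a bijection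
  from \<open>A\<close> to \<open>B\<close>, so that the assumptions are symmetric in
  \<open>A\<close> and \<open>B\<close>.\<close>

locale prism_graph =
  fixes f :: "'a \<Rightarrow> 'a" and A B :: "'a set"
  assumes finite: "finite A" "finite B"
    and disjoint: "A \<inter> B = {}"
    and image: "f ` A = B" "f ` B = A"
    and involution: "\<And>x. x \<in> A \<union> B \<Longrightarrow> f (f x) = x"
begin

lemma swap: "prism_graph f B A"
  using finite disjoint image involution by unfold_locales auto

lemma prism_swap: "prism f B A = prism f A B"
proof -
  have "(\<lambda>x. {x, f x}) ` B = (\<lambda>x. {f x, f (f x)}) ` A"
    by (simp add: image(1)[symmetric] image_image)
  also have "\<dots> = (\<lambda>x. {x, f x}) ` A"
    by (rule image_cong) (auto simp: involution)
  finally show ?thesis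
    by (auto simp: prism_def)
qed

lemma f_in_B: "x \<in> A \<Longrightarrow> f x \<in> B"
  using image by blast

lemma f_eq_iff: "x \<in> A \<Longrightarrow> y \<in> A \<Longrightarrow> f x = f y \<longleftrightarrow> x = y"
  by (metis UnI1 involution)

lemma neq: "x \<in> A \<Longrightarrow> y \<in> B \<Longrightarrow> x \<noteq> y"
  using disjoint by blast

lemma finite_graph_prism: "finite_graph (A \<union> B) (prism f A B)"
proof -
  have "{x, f x} \<in> pairs (A \<union> B)" if "x \<in> A" for x
    using that f_in_B neq by (auto simp: pair_in_pairs_iff)
  then show ?thesis
    using finite pairs_mono[of A "A \<union> B"] pairs_mono[of B "A \<union> B"]
    by (auto simp: finite_graph_def prism_def)
qed

lemma opt_cost_prism_le:
  assumes "A \<noteq> {}"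
  shows "opt_cost (A \<union> B) (prism f A B) \<le> card A"
proof -
  have "partition_on (A \<union> B) {A, B}"
    using assms disjoint image by (auto simp: partition_on_def disjoint_def)
  then have "opt_cost (A \<union> B) (prism f A B) \<le> cost (prism f A B) {A, B}"
    using finite by (intro opt_cost_le) auto
  also have "\<dots> \<le> card ((\<lambda>x. {x, f x}) ` A)"
    unfolding cost_def using finite
    by (intro card_mono) (auto simp: prism_def cluster_edges_def)
  also have "\<dots> \<le> card A"
    using finite by (intro card_image_le)
  finally show ?thesis .
qed

lemma edge_prism_iff:
  assumes "a \<in> A" "b \<in> B"
  shows "{a, b} \<in> prism f A B \<longleftrightarrow> b = f a"
  using assms f_in_B neq[of _ b] neq[OF assms(1)]
  by (auto simp: prism_def pair_in_pairs_iff doubleton_eq_iff)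

lemma closed_nbhd_prism:
  assumes "u \<in> A"
  shows "closed_nbhd (A \<union> B) (prism f A B) u = insert (f u) A"
proof -
  have "{u, v} \<in> prism f A B" if "v \<in> A" "v \<noteq> u" for v
    using assms that by (auto simp: prism_def pair_in_pairs_iff)
  then show ?thesis
    using assms f_in_B edge_prism_iff[OF assms] by (auto simp: closed_nbhd_def)
qed

text \<open>Three disjoint families of \<open>card A - 1\<close> wrongly treated pairs are counted:
  \<open>S1\<close>, non-edges inside the pivot cluster; \<open>S2\<close>, edges of the clique
  \<open>B\<close> that separate \<open>f u\<close> from its rest; \<open>S3\<close>, matching edges
  that are cut.\<close>

lemma cost_insert_cluster_ge:
  assumes u: "u \<in> A"
    and C: "\<And>X. X \<in> C \<Longrightarrow> X \<subseteq> A \<union> B - insert (f u) A"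
  shows "3 * (card A - 1) \<le> cost (prism f A B) (insert (insert (f u) A) C)"
proof -
  \<comment> \<open>The vertex \<open>u\<close> is left out because \<open>{u, f u}\<close> is an
    edge inside the cluster and costs nothing.\<close>
  define W where "W = A - {u}"
  define S1 where "S1 = (\<lambda>w. {w, f u}) ` W"
  define S2 where "S2 = (\<lambda>w. {f u, f w}) ` W"
  define S3 where "S3 = (\<lambda>w. {w, f w}) ` W"
  let ?E = "prism f A B"
  let ?F = "cluster_edges (insert (insert (f u) A) C)"
  have W: "w \<in> A" "w \<noteq> u" "f w \<in> B" "f u \<noteq> f w" "f w \<noteq> f u" "f w \<notin> A" "f w \<notin> W" "w \<notin> B"
    if "w \<in> W" for w
    using that u f_in_B f_eq_iff disjoint by (auto simp: W_def)
  have fu: "f u \<in> B" "f u \<notin> A"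
    using u f_in_B disjoint by auto
  \<comment> \<open>Members of \<open>C\<close> avoid the pivot cluster, so a pair meeting that
    cluster is joined only if it lies inside it. Every pair in \<open>S1\<close>, \<open>S2\<close>
    and \<open>S3\<close> meets it.\<close>
  have F: "{a, b} \<in> ?F \<longleftrightarrow> {a, b} \<in> pairs (insert (f u) A)" if "a \<in> insert (f u) A" for a b
  proof -
    have "{a, b} \<notin> cluster_edges C"
      using that subsetD[OF cluster_edges_subset[of C, OF C], of "{a, b}"]
      by (auto simp: pair_in_pairs_iff)
    then show ?thesis
      by (simp add: cluster_edges_insert)
  qed
  have S1: "S1 \<subseteq> sym_diff ?E ?F"
    using W fu edge_prism_iff by (auto simp: S1_def F pair_in_pairs_iff)
  have "{f u, f w} \<in> ?E" if "w \<in> W" for w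
    using W[OF that] fu by (auto simp: prism_def pair_in_pairs_iff)
  then have S2: "S2 \<subseteq> sym_diff ?E ?F"
    using W by (auto simp: S2_def F pair_in_pairs_iff)
  have S3: "S3 \<subseteq> sym_diff ?E ?F"
    using W edge_prism_iff by (auto simp: S3_def F pair_in_pairs_iff)
  have fin: "finite S1" "finite S2" "finite S3"
    using finite by (auto simp: S1_def S2_def S3_def W_def)
  have "inj_on (\<lambda>w. {w, f u}) W" "inj_on (\<lambda>w. {f u, f w}) W" "inj_on (\<lambda>w. {w, f w}) W"
    using W fu f_eq_iff by (auto simp: inj_on_def doubleton_eq_iff)
  moreover have "card W = card A - 1"
    using u finite by (simp add: W_def)
  ultimately have card: "card S1 = card A - 1" "card S2 = card A - 1" "card S3 = card A - 1"
    by (simp_all add: S1_def S2_def S3_def card_image)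
  \<comment> \<open>Pairs in \<open>S2\<close> lie within \<open>B\<close>, the others cross between
    the sides; the end in \<open>B\<close> is \<open>f u\<close> in \<open>S1\<close> and differs
    from \<open>f u\<close> in \<open>S3\<close>.\<close>
  have disj: "S1 \<inter> S2 = {}" "(S1 \<union> S2) \<inter> S3 = {}"
    using W fu by (fastforce simp: S1_def S2_def S3_def doubleton_eq_iff)+
  have "?F \<subseteq> pairs (A \<union> B)"
    using C fu by (intro cluster_edges_subset) auto
  then have "Finite_Set.finite (sym_diff ?E ?F)"
    using finite_graph_prism finite_pairs finite
    by (metis finite_graph_def finite_Diff finite_UnI finite_subset)
  then have "card (S1 \<union> S2 \<union> S3) \<le> card (sym_diff ?E ?F)"
    using S1 S2 S3 by (intro card_mono) auto
  moreover have "card (S1 \<union> S2 \<union> S3) = 3 * (card A - 1)"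
    using fin disj card by (simp add: card_Un_disjoint)
  ultimately show ?thesis
    by (simp add: cost_def)
qed

lemma cost_first_pivot_ge:
  assumes "u \<in> A"
    and "pivot_output (A \<union> B - closed_nbhd (A \<union> B) (prism f A B) u) E' C"
  shows "3 * (card A - 1)
    \<le> cost (prism f A B) (insert (closed_nbhd (A \<union> B) (prism f A B) u) C)"
  using assms pivot_output_subset[OF assms(2)]
  by (simp only: closed_nbhd_prism cost_insert_cluster_ge)

lemma pivot_cost_ge:
  assumes "pivot_output (A \<union> B) (prism f A B) C" "A \<noteq> {}"
  shows "3 * (card A - 1) \<le> cost (prism f A B) C"
  using assms(1)
proof cases
  case stop
  with assms(2) show ?thesis by simp
next
  case (pick u K D)
  \<comment> \<open>This covers a first pivot in \<open>B\<close>; its bound is in terms of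
    \<open>card B\<close>, hence the equality of cardinalities below.\<close>
  interpret swapped: prism_graph f B A by (rule swap)
  have "card B = card A"
    using image card_image_le finite by (metis le_antisym)
  then show ?thesis
    using pick cost_first_pivot_ge[of u _ D] swapped.cost_first_pivot_ge[of u _ D]
    by (auto simp: prism_swap Un_commute)
qed

end

lemma prism_graph_nat:
  "prism_graph (\<lambda>i::nat. if i < n then i + n else i - n) {..<n} {n..<2 * n}"
proof
  let ?f = "\<lambda>i::nat. if i < n then i + n else i - n"
  show "?f ` {..<n} = {n..<2 * n}"
  proof
    show "{n..<2 * n} \<subseteq> ?f ` {..<n}"
    proof
      fix x assume "x \<in> {n..<2 * n}"
      then show "x \<in> ?f ` {..<n}"
        by (intro image_eqI[of _ _ "x - n"]) auto
    qed
  qed auto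
  show "?f ` {n..<2 * n} = {..<n}"
  proof
    show "{..<n} \<subseteq> ?f ` {n..<2 * n}"
    proof
      fix x assume "x \<in> {..<n}"
      then show "x \<in> ?f ` {n..<2 * n}"
        by (intro image_eqI[of _ _ "x + n"]) auto
    qed
  qed auto
qed auto

theorem theorem3:
  "\<not> (\<exists>\<epsilon>::real. \<epsilon> > 0 \<and>
      (\<exists>A :: nat set \<Rightarrow> nat set set \<Rightarrow> nat set set.
        pivot_algorithm A \<and> approximation_factor A (3 - \<epsilon>)))"
proof clarify
  fix \<epsilon> :: real and A :: "nat set \<Rightarrow> nat set set \<Rightarrow> nat set set"
  assume \<epsilon>: "\<epsilon> > 0" and alg: "pivot_algorithm A" and appr: "approximation_factor A (3 - \<epsilon>)"
  obtain m where m: "3 / \<epsilon> < real m"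
    using reals_Archimedean2 by blast
  \<comment> \<open>Exceeding \<open>m\<close> gives \<epsilon> n > 3, and n \<ge> 2 makes the lower
    bound 3 (n - 1) positive.\<close>
  define n where "n = m + 2"
  interpret prism_graph "\<lambda>i::nat. if i < n then i + n else i - n" "{..<n}" "{n..<2 * n}"
    by (rule prism_graph_nat)
  define V where "V = {..<n} \<union> {n..<2 * n}"
  define E where "E = prism (\<lambda>i::nat. if i < n then i + n else i - n) {..<n} {n..<2 * n}"
  have graph: "finite_graph V E"
    unfolding V_def E_def by (rule finite_graph_prism)
  have "pivot_output V E (A V E)"
    using alg graph by (simp add: pivot_algorithm_def)
  then have "3 * (n - 1) \<le> cost E (A V E)"
    using pivot_cost_ge[of "A V E"] by (auto simp: V_def E_def n_def)
  then have "3 * (real n - 1) \<le> real (cost E (A V E))"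
    by (simp add: n_def)
  also have "\<dots> \<le> (3 - \<epsilon>) * real (opt_cost V E)"
    using appr graph by (simp add: approximation_factor_def)
  finally have le: "3 * (real n - 1) \<le> (3 - \<epsilon>) * real (opt_cost V E)" .
  have opt: "opt_cost V E \<le> n"
    using opt_cost_prism_le by (auto simp: V_def E_def n_def)
  \<comment> \<open>Nothing so far excludes \<epsilon> \<ge> 3. The sign of the factor is needed to
    replace the optimum by its upper bound \<open>n\<close>.\<close>
  have "0 < (3 - \<epsilon>) * real (opt_cost V E)"
    using le by (simp add: n_def)
  then have "0 < 3 - \<epsilon>"
    by (simp add: zero_less_mult_iff)
  then have "(3 - \<epsilon>) * real (opt_cost V E) \<le> (3 - \<epsilon>) * real n"
    using opt by (intro mult_left_mono) auto
  with le have "\<epsilon> * real n \<le> 3"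
    by (simp add: algebra_simps)
  moreover have "3 < \<epsilon> * real m"
    using m \<epsilon> by (simp add: field_simps)
  moreover have "\<epsilon> * real m \<le> \<epsilon> * real n"
    using \<epsilon> by (simp add: n_def)
  ultimately show False by linarith
qed

end
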